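(* Let $(X,\tau)$ be a topological space and let $A \subseteq X$. The following are equivalent: (1) $A$ is an $\mathcal{AB}$-set. (2) $A$ is semi-open and a $\mathcal{B}$-set. (3) $A$ is $\beta$-open and a $\mathcal{B}$-set.
   Context: For a subset $A$ of a topological space $X$, $\mathrm{Int}\,A$ denotes the interior and $\overline{A}$ the closure of $A$ in $X$. $A$ is semi-open if $A \subseteq \overline{\mathrm{Int}\,A}$; semi-closed if its complement is semi-open (equivalently $\mathrm{Int}\,\overline{A} \subseteq A$); semi-regular if it is both semi-open and semi-closed; $\beta$-open if $A \subseteq \overline{\mathrm{Int}\,\overline{A}}$. $A$ is an $\mathcal{AB}$-set if $A = U \cap V$ with $U$ open and $V$ semi-regular. $A$ is a $\mathcal{B}$-set if $A = U \cap V$ with $U$ open and $V$ semi-closed. No separation axioms are assumed. *)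

theory Defs
  imports "HOL-Analysis.Abstract_Topology"
begin

text \<open>All notions are relative to a topology \<^term>\<open>X\<close>; each of them implies that the set in
  question is contained in \<^term>\<open>topspace X\<close>. For the (semi-)open notions this follows from the
  closure being contained in \<^term>\<open>topspace X\<close>; for semi-closed sets it is required
  explicitly, as in the library definition of \<^const>\<open>closedin\<close>.\<close>

definition semi_openin :: "'a topology \<Rightarrow> 'a set \<Rightarrow> bool" where
  "semi_openin X A \<longleftrightarrow> A \<subseteq> X closure_of (X interior_of A)"

definition semi_closedin :: "'a topology \<Rightarrow> 'a set \<Rightarrow> bool" where
  "semi_closedin X A \<longleftrightarrow> A \<subseteq> topspace X \<and> semi_openin X (topspace X - A)"

definition semi_regularin :: "'a topology \<Rightarrow> 'a set \<Rightarrow> bool" where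
  "semi_regularin X A \<longleftrightarrow> semi_openin X A \<and> semi_closedin X A"

definition beta_openin :: "'a topology \<Rightarrow> 'a set \<Rightarrow> bool" where
  "beta_openin X A \<longleftrightarrow> A \<subseteq> X closure_of (X interior_of (X closure_of A))"

definition AB_set :: "'a topology \<Rightarrow> 'a set \<Rightarrow> bool" where
  "AB_set X A \<longleftrightarrow> (\<exists>U V. openin X U \<and> semi_regularin X V \<and> A = U \<inter> V)"

definition B_set :: "'a topology \<Rightarrow> 'a set \<Rightarrow> bool" where
  "B_set X A \<longleftrightarrow> (\<exists>U V. openin X U \<and> semi_closedin X V \<and> A = U \<inter> V)"

end

theory Submission
  imports Defs
begin

text \<open>If \<open>A = U \<inter> V\<close> is \<open>\<beta>\<close>-open, with \<open>U\<close> open and \<open>V\<close> semi-closed, then \<open>V\<close> may be replaced by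
  the semi-closure \<open>A \<union> Int (cl A)\<close>: it is the smallest semi-closed superset of \<open>A\<close>, so it still
  cuts \<open>A\<close> out of \<open>U\<close>, and \<open>\<beta>\<close>-openness of \<open>A\<close> makes it semi-open.\<close>

text \<open>Complementation swaps interior and closure; semi-closedness is used below only in this
  form.\<close>

lemma semi_closedin_iff:
  "semi_closedin X A \<longleftrightarrow> A \<subseteq> topspace X \<and> X interior_of (X closure_of A) \<subseteq> A"
  using interior_of_subset_topspace[of X "X closure_of A"]
  by (auto simp: semi_closedin_def semi_openin_def interior_of_complement closure_of_complement)

lemma semi_openin_imp_beta_openin:
  assumes "semi_openin X A"
  shows "beta_openin X A"
proof -
  have "A \<subseteq> topspace X"
    using assms closure_of_subset_topspace unfolding semi_openin_def by fast
  then have "X closure_of (X interior_of A) \<subseteq> X closure_of (X interior_of (X closure_of A))"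
    by (intro closure_of_mono interior_of_mono closure_of_subset)
  with assms show ?thesis
    unfolding semi_openin_def beta_openin_def by blast
qed

text \<open>An open \<open>U\<close> can be moved inside a closure, and interior commutes with
  binary intersections, so \<open>U\<close> passes through both operators.\<close>

lemma semi_openin_Int_open:
  assumes "openin X U" "semi_openin X V"
  shows "semi_openin X (U \<inter> V)"
proof -
  have "U \<inter> V \<subseteq> U \<inter> X closure_of (X interior_of V)"
    using assms(2) unfolding semi_openin_def by blast
  also have "\<dots> \<subseteq> X closure_of (U \<inter> X interior_of V)"
    using assms(1) by (rule openin_Int_closure_of_subset)
  also have "\<dots> = X closure_of (X interior_of (U \<inter> V))"
    using assms(1) by (simp add: interior_of_Int interior_of_openin)
  finally show ?thesis
    unfolding semi_openin_def .
qed

lemma semi_regularin_semi_closure: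
  assumes "beta_openin X A"
  shows "semi_regularin X (A \<union> X interior_of (X closure_of A))" (is "semi_regularin X ?W")
proof -
  have A: "A \<subseteq> topspace X"
    using assms closure_of_subset_topspace unfolding beta_openin_def by fast
  \<comment> \<open>Being trapped below the closure of \<open>A\<close>, \<open>?W\<close> has a
    closure whose interior is at most \<open>X interior_of (X closure_of A)\<close>, already a part
    of \<open>?W\<close>.\<close>
  have "?W \<subseteq> X closure_of A"
    using closure_of_subset[OF A] interior_of_subset by fast
  then have "X closure_of ?W \<subseteq> X closure_of A"
    by (simp add: closure_of_minimal)
  then have "semi_closedin X ?W"
    using A interior_of_mono interior_of_subset_topspace
    unfolding semi_closedin_iff by (metis Un_least le_supI2)
  moreover have "X interior_of (X closure_of A) \<subseteq> X interior_of ?W"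
    by (simp add: interior_of_maximal)
  then have "X closure_of (X interior_of (X closure_of A)) \<subseteq> X closure_of (X interior_of ?W)"
    by (rule closure_of_mono)
  \<comment> \<open>Only the part \<open>A\<close> needs \<beta>-openness; the other part lies in
    its own closure.\<close>
  moreover have "?W \<subseteq> X closure_of (X interior_of (X closure_of A))"
    using assms unfolding beta_openin_def
    by (simp add: closure_of_subset interior_of_subset_topspace)
  ultimately show ?thesis
    unfolding semi_regularin_def semi_openin_def by blast
qed

lemma AB_set_imp_semi_openin: "AB_set X A \<Longrightarrow> semi_openin X A"
  unfolding AB_set_def semi_regularin_def by (auto intro: semi_openin_Int_open)

lemma AB_set_imp_B_set: "AB_set X A \<Longrightarrow> B_set X A"
  unfolding AB_set_def B_set_def semi_regularin_def by blast

lemma beta_openin_B_set_imp_AB_set: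
  assumes "beta_openin X A" "B_set X A"
  shows "AB_set X A"
proof -
  obtain U V where U: "openin X U" and V: "semi_closedin X V" and A: "A = U \<inter> V"
    using assms(2) unfolding B_set_def by blast
  have "X interior_of (X closure_of A) \<subseteq> X interior_of (X closure_of V)"
    unfolding A by (intro interior_of_mono closure_of_mono) simp
  also have "\<dots> \<subseteq> V"
    using V unfolding semi_closedin_iff by blast
  \<comment> \<open>Both parts of the union lie in \<open>V\<close>, so cutting with
    \<open>U\<close> yields nothing outside \<open>A\<close>.\<close>
  finally have "A = U \<inter> (A \<union> X interior_of (X closure_of A))"
    using A by blast
  then show ?thesis
    using U semi_regularin_semi_closure[OF assms(1)] unfolding AB_set_def by blast
qed

theorem theorem2p4:
  fixes X :: "'a topology" and A :: "'a set"
  assumes "A \<subseteq> topspace X"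
  shows "(AB_set X A \<longleftrightarrow> semi_openin X A \<and> B_set X A) \<and>
         (semi_openin X A \<and> B_set X A \<longleftrightarrow> beta_openin X A \<and> B_set X A)"
  using AB_set_imp_semi_openin AB_set_imp_B_set semi_openin_imp_beta_openin
    beta_openin_B_set_imp_AB_set by blast

end
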